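(* For all $1\le i,j\le n$, $$(A_h^{-1})_{ij}=\frac{S(1,\min\{i,j\})\,S(\max\{i,j\}+1,n+1)}{S(1,n+1)}.$$ In particular, $(A_h^{-1})_{ij}>0$ and $(A_h^{-1})_{ij}=(A_h^{-1})_{ji}$ for all $1\le i,j\le n$.
   Context: Let $n\ge 1$ be an integer and let $\beta_{i+\frac12}>0$, $i=0,\ldots,n$, be given positive real numbers (face coefficients). $A_h$ is the $n\times n$ tridiagonal matrix acting on $U=(U_1,\ldots,U_n)^T$, with the convention $U_0=U_{n+1}=0$, by $$(A_hU)_i=-\beta_{i-\frac12}U_{i-1}+\left(\beta_{i-\frac12}+\beta_{i+\frac12}\right)U_i-\beta_{i+\frac12}U_{i+1},\qquad 1\le i\le n.$$ Set $s_k:=1/\beta_{k-\frac12}$ for $k=1,\ldots,n+1$, and $S(c,d):=\sum_{k=c}^{d}s_k$ if $c\le d$, $S(c,d):=0$ if $c>d$. *)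

theory Defs
  imports Complex_Main "Jordan_Normal_Form.Determinant"
begin

text \<open>
  Conventions. The face coefficient with half-integer index \<open>i + 1/2\<close> is \<open>\<beta> i\<close>, so the one with
  index \<open>i - 1/2\<close> is \<open>\<beta> (i - 1)\<close>; the latter is only used for \<open>i \<ge> 1\<close>, where subtraction on
  \<^typ>\<open>nat\<close> does not truncate. Grid indices run from 1 to \<open>n\<close>, whereas rows and columns of
  \<^typ>\<open>real mat\<close> are numbered from 0: grid index \<open>i\<close> corresponds to row (or column) \<open>i - 1\<close>.
\<close>

definition A_h :: "nat \<Rightarrow> (nat \<Rightarrow> real) \<Rightarrow> real mat" where
  "A_h n \<beta> = mat n n (\<lambda>(r, c).
     let i = r + 1; j = c + 1 in
       if j + 1 = i then - \<beta> (i - 1)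
       else if j = i then \<beta> (i - 1) + \<beta> i
       else if j = i + 1 then - \<beta> i
       else 0)"

definition s :: "(nat \<Rightarrow> real) \<Rightarrow> nat \<Rightarrow> real" where
  "s \<beta> k = 1 / \<beta> (k - 1)"

definition S :: "(nat \<Rightarrow> real) \<Rightarrow> nat \<Rightarrow> nat \<Rightarrow> real" where
  "S \<beta> c d = (if c \<le> d then \<Sum>k = c..d. s \<beta> k else 0)"

text \<open>The matrix acts on grid functions vanishing at 0 and \<open>n + 1\<close> by the three-point stencil.\<close>

lemma A_h_action:
  fixes U :: "nat \<Rightarrow> real"
  assumes "U 0 = 0" and "U (n + 1) = 0" and "1 \<le> i" and "i \<le> n"
  shows "(A_h n \<beta> *\<^sub>v vec n (\<lambda>r. U (r + 1))) $ (i - 1)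
    = - \<beta> (i - 1) * U (i - 1) + (\<beta> (i - 1) + \<beta> i) * U i - \<beta> i * U (i + 1)"
proof -
  have "(A_h n \<beta> *\<^sub>v vec n (\<lambda>r. U (r + 1))) $ (i - 1)
    = (\<Sum>c = 0..<n. A_h n \<beta> $$ (i - 1, c) * U (c + 1))"
    using assms by (auto simp: A_h_def scalar_prod_def intro!: sum.cong)
  also have "\<dots> = (\<Sum>c = 0..<n.
      (if c + 2 = i then - \<beta> (i - 1) * U (i - 1) else 0)
      + (if c = i - 1 then (\<beta> (i - 1) + \<beta> i) * U i else 0)
      + (if c = i then - \<beta> i * U (i + 1) else 0))"
    using assms by (intro sum.cong) (auto simp: A_h_def Let_def)
  also have "\<dots> = (\<Sum>c = 0..<n. if c + 2 = i then - \<beta> (i - 1) * U (i - 1) else 0)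
      + (\<beta> (i - 1) + \<beta> i) * U i + (if i < n then - \<beta> i * U (i + 1) else 0)"
    using assms by (simp add: sum.distrib)
  also have "(if i < n then - \<beta> i * U (i + 1) else 0) = - \<beta> i * U (i + 1)"
    using assms by (cases "i = n") auto
  also have "(\<Sum>c = 0..<n. if c + 2 = i then - \<beta> (i - 1) * U (i - 1) else 0)
      = - \<beta> (i - 1) * U (i - 1)"
  proof (cases "i = 1")
    case True
    then show ?thesis using assms by simp
  next
    case False
    then have "(c + 2 = i) = (c = i - 2)" for c using assms by auto
    then show ?thesis using assms by simp
  qed
  finally show ?thesis by simp
qed

end

theory Submission
  imports Defs
begin

text \<open>
  The claimed inverse is the Green's function of the discrete analogue of the operator
  \<open>u \<mapsto> - (\<beta> u')'\<close> with Dirichlet conditions. For a fixed source point \<open>j\<close>, the grid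
  function \<open>i \<mapsto> green n \<beta> i j\<close> vanishes at \<open>0\<close> and at \<open>n + 1\<close>, and it is affine in the
  resistance coordinate \<open>S \<beta> 1 i\<close> on either side of \<open>j\<close>. Since the increment of this coordinate
  from \<open>i\<close> to \<open>i + 1\<close> is \<open>1 / \<beta> i\<close>, the flux \<open>\<beta> i * (U (i + 1) - U i)\<close> of the Green's
  function is constant on either side of \<open>j\<close> and drops by exactly 1 there (\<open>green_flux\<close>).
  The three-point stencil is the negative difference of consecutive fluxes, so it sends the Green's
  function to the unit vector at \<open>j\<close> (\<open>green_stencil\<close>). The Green's matrix is
  therefore a right inverse of \<open>A_h n \<beta>\<close>, and a right inverse of a square matrix is its unique
  two-sided inverse. Positivity and symmetry can be read off the formula.
\<close>

definition green :: "nat \<Rightarrow> (nat \<Rightarrow> real) \<Rightarrow> nat \<Rightarrow> nat \<Rightarrow> real" where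
  "green n \<beta> i j = S \<beta> 1 (min i j) * S \<beta> (max i j + 1) (n + 1) / S \<beta> 1 (n + 1)"

definition green_mat :: "nat \<Rightarrow> (nat \<Rightarrow> real) \<Rightarrow> real mat" where
  "green_mat n \<beta> = mat n n (\<lambda>(r, c). green n \<beta> (r + 1) (c + 1))"

lemma S_eq_sum: "S \<beta> c d = (\<Sum>k = c..d. s \<beta> k)"
  by (simp add: S_def)

lemma S_split_last: "S \<beta> 1 (i + 1) = S \<beta> 1 i + 1 / \<beta> i"
  by (simp add: S_eq_sum s_def)

lemma S_split_first: "i \<le> n \<Longrightarrow> S \<beta> (i + 1) (n + 1) = 1 / \<beta> i + S \<beta> (i + 2) (n + 1)"
  by (cases "i = n") (simp_all add: S_eq_sum s_def sum.atLeast_Suc_atMost)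

lemma S_split_at:
  assumes "j \<le> n"
  shows "S \<beta> 1 (n + 1) = S \<beta> 1 j + S \<beta> (j + 1) (n + 1)"
  using sum.ub_add_nat[of 1 j "s \<beta>" "n + 1 - j"] assms by (simp add: S_eq_sum)

lemma S_pos:
  assumes "\<And>i. i \<le> n \<Longrightarrow> \<beta> i > 0" and "c \<le> d" and "d \<le> n + 1"
  shows "S \<beta> c d > 0"
  unfolding S_eq_sum using assms by (intro sum_pos) (auto simp: s_def)

lemma green_sym: "green n \<beta> i j = green n \<beta> j i"
  by (simp add: green_def min.commute max.commute)

lemma green_pos:
  assumes "\<And>i. i \<le> n \<Longrightarrow> \<beta> i > 0" and "i \<in> {1..n}" and "j \<in> {1..n}"
  shows "green n \<beta> i j > 0"
  unfolding green_def using assms(2,3)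
  by (intro divide_pos_pos mult_pos_pos S_pos[OF assms(1)]) auto

lemma green_boundary:
  assumes "j \<le> n"
  shows "green n \<beta> 0 j = 0" and "green n \<beta> (n + 1) j = 0"
  using assms by (simp_all add: green_def S_def)

text \<open>
  Only one of the two factors of the numerator changes from \<open>i\<close> to \<open>i + 1\<close>: the first one to the
  left of \<open>j\<close>, the second one from \<open>j\<close> on. Its change is \<open>1 / \<beta> i\<close> up to sign, which cancels
  the face coefficient.
\<close>
lemma green_flux:
  assumes "\<beta> i \<noteq> 0" and "i \<le> n"
  shows "\<beta> i * (green n \<beta> (i + 1) j - green n \<beta> i j)
    = (if i < j then S \<beta> (j + 1) (n + 1) else - S \<beta> 1 j) / S \<beta> 1 (n + 1)"
proof (cases "i < j")
  case True
  then have "min (i + 1) j = i + 1" "max (i + 1) j = j" "min i j = i" "max i j = j" by auto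
  then have "green n \<beta> (i + 1) j - green n \<beta> i j
      = (1 / \<beta> i) * S \<beta> (j + 1) (n + 1) / S \<beta> 1 (n + 1)"
    unfolding green_def using S_split_last[of \<beta> i]
    by (simp add: algebra_simps add_divide_distrib)
  then show ?thesis using True assms by simp
next
  case False
  then have "min (i + 1) j = j" "max (i + 1) j = i + 1" "min i j = j" "max i j = i" by auto
  then have "green n \<beta> (i + 1) j - green n \<beta> i j
      = - (1 / \<beta> i) * S \<beta> 1 j / S \<beta> 1 (n + 1)"
    unfolding green_def using S_split_first[OF assms(2), of \<beta>]
    by (simp add: algebra_simps add_divide_distrib)
  then show ?thesis using False assms by simp
qed

text \<open>
  Away from \<open>j\<close> the fluxes through both faces of \<open>i\<close> agree. At \<open>i = j\<close> their difference is the sum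
  of all \<open>s \<beta> k\<close> divided by itself.
\<close>
lemma green_stencil:
  assumes pos: "\<And>i. i \<le> n \<Longrightarrow> \<beta> i > 0" and i: "i \<in> {1..n}" and j: "j \<in> {1..n}"
  shows "- \<beta> (i - 1) * green n \<beta> (i - 1) j + (\<beta> (i - 1) + \<beta> i) * green n \<beta> i j
      - \<beta> i * green n \<beta> (i + 1) j = (if i = j then 1 else 0)"
    (is "?L = _")
proof -
  have nz: "\<beta> (i - 1) \<noteq> 0" "\<beta> i \<noteq> 0"
    using pos[of "i - 1"] pos[of i] i by fastforce+
  have T: "S \<beta> 1 (n + 1) > 0" using S_pos[OF pos, where c = 1] by simp
  have "?L = \<beta> (i - 1) * (green n \<beta> (i - 1 + 1) j - green n \<beta> (i - 1) j)
      - \<beta> i * (green n \<beta> (i + 1) j - green n \<beta> i j)"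
    using i by (simp add: algebra_simps)
  also have "\<dots> = (if i \<le> j then S \<beta> (j + 1) (n + 1) else - S \<beta> 1 j) / S \<beta> 1 (n + 1)
      - (if i < j then S \<beta> (j + 1) (n + 1) else - S \<beta> 1 j) / S \<beta> 1 (n + 1)"
  proof -
    have "i - 1 \<le> n" "i \<le> n" "(i - 1 < j) = (i \<le> j)" using i by auto
    then show ?thesis using nz by (simp only: green_flux not_False_eq_True)
  qed
  also have "\<dots> = (if i = j then 1 else 0)"
  proof (cases "i = j")
    case True
    have "S \<beta> (j + 1) (n + 1) / S \<beta> 1 (n + 1) + S \<beta> 1 j / S \<beta> 1 (n + 1) = 1"
      using S_split_at[of j n \<beta>] T j by (simp flip: add_divide_distrib)
    then show ?thesis using True by simp
  qed auto
  finally show ?thesis .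
qed

lemma A_h_carrier: "A_h n \<beta> \<in> carrier_mat n n"
  by (simp add: A_h_def)

lemma green_mat_carrier: "green_mat n \<beta> \<in> carrier_mat n n"
  by (simp add: green_mat_def)

lemma A_h_mult_green_mat:
  assumes pos: "\<And>i. i \<le> n \<Longrightarrow> \<beta> i > 0"
  shows "A_h n \<beta> * green_mat n \<beta> = 1\<^sub>m n"
proof (rule eq_matI)
  fix r c assume "r < dim_row (1\<^sub>m n :: real mat)" "c < dim_col (1\<^sub>m n :: real mat)"
  then have r: "r < n" and c: "c < n" by auto
  let ?U = "\<lambda>i. green n \<beta> i (c + 1)"
  have "(A_h n \<beta> * green_mat n \<beta>) $$ (r, c) = (A_h n \<beta> *\<^sub>v col (green_mat n \<beta>) c) $ r"
    using r c A_h_carrier[of n \<beta>] green_mat_carrier[of n \<beta>] by simp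
  also have "col (green_mat n \<beta>) c = vec n (\<lambda>r. ?U (r + 1))"
    using c by (intro eq_vecI) (auto simp: green_mat_def)
  also have "(A_h n \<beta> *\<^sub>v vec n (\<lambda>r. ?U (r + 1))) $ r
      = - \<beta> (r + 1 - 1) * ?U (r + 1 - 1) + (\<beta> (r + 1 - 1) + \<beta> (r + 1)) * ?U (r + 1)
        - \<beta> (r + 1) * ?U (r + 1 + 1)"
    using A_h_action[of ?U n "r + 1" \<beta>] green_boundary[of "c + 1" n \<beta>] r c by simp
  also have "\<dots> = (if r + 1 = c + 1 then 1 else 0)"
    using r c by (intro green_stencil[OF pos]) auto
  finally show "(A_h n \<beta> * green_mat n \<beta>) $$ (r, c) = 1\<^sub>m n $$ (r, c)"
    using r c by simp
qed (simp_all add: A_h_def green_mat_def)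

theorem theorem2p1:
  fixes n :: nat and \<beta> :: "nat \<Rightarrow> real"
  assumes "n \<ge> 1"
    and "\<And>i. i \<le> n \<Longrightarrow> \<beta> i > 0"
  shows "invertible_mat (A_h n \<beta>) \<and>
    (\<forall>B \<in> carrier_mat n n. inverts_mat (A_h n \<beta>) B \<and> inverts_mat B (A_h n \<beta>) \<longrightarrow>
      (\<forall>i \<in> {1..n}. \<forall>j \<in> {1..n}.
        B $$ (i - 1, j - 1)
          = S \<beta> 1 (min i j) * S \<beta> (max i j + 1) (n + 1) / S \<beta> 1 (n + 1)
        \<and> B $$ (i - 1, j - 1) > 0
        \<and> B $$ (i - 1, j - 1) = B $$ (j - 1, i - 1)))"
proof (intro conjI ballI impI)
  note A = A_h_carrier[of n \<beta>] and G = green_mat_carrier[of n \<beta>]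
  have AG: "A_h n \<beta> * green_mat n \<beta> = 1\<^sub>m n"
    using assms(2) by (rule A_h_mult_green_mat)
  have GA: "green_mat n \<beta> * A_h n \<beta> = 1\<^sub>m n"
    by (rule mat_mult_left_right_inverse[OF A G AG])
  show "invertible_mat (A_h n \<beta>)"
    unfolding invertible_mat_def inverts_mat_def using A G AG GA by auto
  fix B i j
  assume B: "B \<in> carrier_mat n n"
    and inv: "inverts_mat (A_h n \<beta>) B \<and> inverts_mat B (A_h n \<beta>)"
    and i: "i \<in> {1..n}" and j: "j \<in> {1..n}"
  have "B = B * (A_h n \<beta> * green_mat n \<beta>)" using B AG by simp
  also have "\<dots> = (B * A_h n \<beta>) * green_mat n \<beta>" using A B G by simp
  also have "\<dots> = green_mat n \<beta>" using inv B G by (simp add: inverts_mat_def)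
  finally have B_eq: "B $$ (k - 1, l - 1) = green n \<beta> k l"
    if "k \<in> {1..n}" "l \<in> {1..n}" for k l
    using that by (auto simp: green_mat_def)
  show "B $$ (i - 1, j - 1)
      = S \<beta> 1 (min i j) * S \<beta> (max i j + 1) (n + 1) / S \<beta> 1 (n + 1)"
    using B_eq[OF i j] by (simp add: green_def)
  show "B $$ (i - 1, j - 1) > 0"
    using B_eq[OF i j] green_pos[OF assms(2) i j] by simp
  show "B $$ (i - 1, j - 1) = B $$ (j - 1, i - 1)"
    using B_eq[OF i j] B_eq[OF j i] green_sym[of n \<beta> i j] by simp
qed

end
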